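(* Let $X$ be a nontrivial real Banach space and let $F:X\times X\to\mathbb{R}$ be a monotone bifunction with $F(x,x)=0$ for all $x\in X$. If $F(x,\cdot)$ is convex and continuous for all $x\in X$ and $F(\cdot,y)$ is upper hemicontinuous for all $y\in X$, then $F$ is maximal monotone.
   Context: $X^*$ is the topological dual of $X$ and $\langle x^*,x\rangle$ the value of $x^*\in X^*$ at $x\in X$. A function is upper hemicontinuous if it is upper semicontinuous on line segments. A bifunction $F:X\times X\to\mathbb{R}$ is monotone if $F(x,y)+F(y,x)\le 0$ for all $x,y\in X$. The operator $A^F:X\rightrightarrows X^*$ is defined by $A^F(x)=\{x^*\in X^*:F(x,y)-F(x,x)\ge\langle x^*,y-x\rangle\ \forall y\in X\}$. The monotone bifunction $F$ is maximal monotone if $A^F$ is a maximal monotone operator, i.e. $A^F$ is monotone ($\langle y^*-x^*,y-x\rangle\ge 0$ whenever $x^*\in A^F(x)$, $y^*\in A^F(y)$) and its graph is not properly included in the graph of another monotone operator $X\rightrightarrows X^*$. *)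

theory Defs
  imports "HOL-Analysis.Analysis"
begin

(* Upper semicontinuity of the restriction of f to S, in the subspace topology of S. *)
definition upper_semicontinuous_on :: "'a::topological_space set \<Rightarrow> ('a \<Rightarrow> real) \<Rightarrow> bool" where
  "upper_semicontinuous_on S f \<longleftrightarrow>
    (\<forall>x\<in>S. \<forall>c. f x < c \<longrightarrow> (\<forall>\<^sub>F y in at x within S. f y < c))"

definition upper_hemicontinuous :: "('a::real_normed_vector \<Rightarrow> real) \<Rightarrow> bool" where
  "upper_hemicontinuous f \<longleftrightarrow> (\<forall>a b. upper_semicontinuous_on (closed_segment a b) f)"

(* The topological dual of X is the type of bounded linear maps from X to the reals;
   a set-valued operator from X to its dual is a function into sets of functionals. *)
type_synonym 'a dual = "'a \<Rightarrow>\<^sub>L real"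

definition operator_graph :: "('a \<Rightarrow> 'b set) \<Rightarrow> ('a \<times> 'b) set" where
  "operator_graph T = {(x, x'). x' \<in> T x}"

definition monotone_operator :: "('a::real_normed_vector \<Rightarrow> 'a dual set) \<Rightarrow> bool" where
  "monotone_operator T \<longleftrightarrow>
    (\<forall>x y. \<forall>x'\<in>T x. \<forall>y'\<in>T y. blinfun_apply (y' - x') (y - x) \<ge> 0)"

definition maximal_monotone_operator :: "('a::real_normed_vector \<Rightarrow> 'a dual set) \<Rightarrow> bool" where
  "maximal_monotone_operator T \<longleftrightarrow>
    monotone_operator T \<and>
    \<not> (\<exists>S. monotone_operator S \<and> operator_graph T \<subset> operator_graph S)"

definition monotone_bifunction :: "('a \<Rightarrow> 'a \<Rightarrow> real) \<Rightarrow> bool" where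
  "monotone_bifunction F \<longleftrightarrow> (\<forall>x y. F x y + F y x \<le> 0)"

definition bifunction_operator ::
    "('a::real_normed_vector \<Rightarrow> 'a \<Rightarrow> real) \<Rightarrow> 'a \<Rightarrow> 'a dual set" where
  "bifunction_operator F x = {x'. \<forall>y. F x y - F x x \<ge> blinfun_apply x' (y - x)}"

definition maximal_monotone_bifunction ::
    "('a::real_normed_vector \<Rightarrow> 'a \<Rightarrow> real) \<Rightarrow> bool" where
  "maximal_monotone_bifunction F \<longleftrightarrow>
    monotone_bifunction F \<and> maximal_monotone_operator (bifunction_operator F)"

end

theory Submission
  imports Defs
begin

text \<open>
  For a continuous convex function the Hahn--Banach theorem yields a subgradient at every point,
  so the operator of \<open>F\<close> has nonempty values everywhere. Suppose \<open>x'\<close> at \<open>x\<close> is monotonically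
  related to its graph. For \<open>z = x + t (y - x)\<close> with \<open>0 < t < 1\<close> and \<open>z'\<close> in the operator at
  \<open>z\<close>, monotonicity gives \<open>z' (y - x) \<ge> x' (y - x)\<close>, and the subgradient inequality at \<open>y\<close> gives
  \<open>F z y \<ge> (1 - t) z' (y - x) \<ge> (1 - t) x' (y - x)\<close>. Letting \<open>t\<close> tend to \<open>0\<close>, upper
  hemicontinuity yields \<open>F x y \<ge> x' (y - x)\<close>.
\<close>

section \<open>Sublinear functionals\<close>

text \<open>Homogeneity is stated as a single inequality because this form is easy to verify for
  infima; applying it with the factor \<open>inverse c\<close> recovers equality in
  \<open>sublinear_scale\<close>.\<close>

definition sublinear :: "('a::real_vector \<Rightarrow> real) \<Rightarrow> bool" where
  "sublinear p \<longleftrightarrow>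
    (\<forall>x y. p (x + y) \<le> p x + p y) \<and> (\<forall>c x. c > 0 \<longrightarrow> p (c *\<^sub>R x) \<le> c * p x)"

lemma sublinearI:
  assumes "\<And>x y. p (x + y) \<le> p x + p y" and "\<And>c x. c > 0 \<Longrightarrow> p (c *\<^sub>R x) \<le> c * p x"
  shows "sublinear p"
  using assms by (simp add: sublinear_def)

lemma sublinear_add: "sublinear p \<Longrightarrow> p (x + y) \<le> p x + p y"
  by (simp add: sublinear_def)

lemma sublinear_scale_le: "sublinear p \<Longrightarrow> c > 0 \<Longrightarrow> p (c *\<^sub>R x) \<le> c * p x"
  by (simp add: sublinear_def)

lemma sublinear_scale:
  assumes "sublinear p" and "c > 0"
  shows "p (c *\<^sub>R x) = c * p x"
proof -
  have "p (inverse c *\<^sub>R (c *\<^sub>R x)) \<le> inverse c * p (c *\<^sub>R x)"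
    using assms by (intro sublinear_scale_le) auto
  with \<open>c > 0\<close> have "c * p x \<le> p (c *\<^sub>R x)"
    by (simp add: field_simps)
  with sublinear_scale_le[OF assms, of x] show ?thesis by simp
qed

lemma sublinear_zero:
  assumes "sublinear p"
  shows "p 0 = 0"
  using sublinear_scale[OF assms, of 2 0] by simp

lemma sublinear_minus:
  assumes "sublinear p"
  shows "- p (- x) \<le> p x"
  using sublinear_add[OF assms, of x "- x"] sublinear_zero[OF assms] by simp

section \<open>Infima of sublinear functionals and the Hahn--Banach theorem\<close>

text \<open>The smaller of two members of a chain lies below both, so its subadditivity gives
  \<open>?g (x + y) \<le> f1 x + f2 y\<close>; the infima over \<open>f1\<close> and
  \<open>f2\<close> can then be taken independently.\<close>

lemma sublinear_INF_chain:
  assumes "C \<noteq> {}" and sub: "\<And>f. f \<in> C \<Longrightarrow> sublinear f"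
    and chain: "\<And>f g. f \<in> C \<Longrightarrow> g \<in> C \<Longrightarrow> f \<le> g \<or> g \<le> f"
    and bdd: "\<And>x. bdd_below ((\<lambda>f. f x) ` C)"
  shows "sublinear (\<lambda>x. INF f\<in>C. f x)"
proof (rule sublinearI)
  fix x y :: 'a
  let ?g = "\<lambda>x. INF f\<in>C. f x"
  have le: "?g (x + y) \<le> f1 x + f2 y" if f12: "f1 \<in> C" "f2 \<in> C" for f1 f2
  proof -
    obtain f where f: "f \<in> C" "f \<le> f1" "f \<le> f2"
      using chain[OF f12] f12 by (meson order_refl)
    have "?g (x + y) \<le> f (x + y)" by (rule cINF_lower[OF bdd f(1)])
    also have "\<dots> \<le> f x + f y" by (rule sublinear_add[OF sub[OF f(1)]])
    also have "\<dots> \<le> f1 x + f2 y" using f(2,3) by (intro add_mono) (auto simp: le_fun_def)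
    finally show ?thesis .
  qed
  have "?g (x + y) - f2 y \<le> ?g x" if "f2 \<in> C" for f2
    using le that by (intro cINF_greatest[OF \<open>C \<noteq> {}\<close>]) (simp add: algebra_simps)
  then have "?g (x + y) - ?g x \<le> ?g y"
    by (intro cINF_greatest[OF \<open>C \<noteq> {}\<close>]) (simp add: algebra_simps)
  then show "?g (x + y) \<le> ?g x + ?g y" by simp
next
  fix c :: real and x :: 'a
  let ?g = "\<lambda>x. INF f\<in>C. f x"
  assume "c > 0"
  have "?g (c *\<^sub>R x) / c \<le> ?g x"
  proof (rule cINF_greatest[OF \<open>C \<noteq> {}\<close>])
    fix f assume "f \<in> C"
    have "?g (c *\<^sub>R x) \<le> f (c *\<^sub>R x)" by (rule cINF_lower[OF bdd \<open>f \<in> C\<close>])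
    also have "\<dots> \<le> c * f x" by (rule sublinear_scale_le[OF sub[OF \<open>f \<in> C\<close>] \<open>c > 0\<close>])
    finally show "?g (c *\<^sub>R x) / c \<le> f x"
      using \<open>c > 0\<close> by (simp add: field_simps)
  qed
  then show "?g (c *\<^sub>R x) \<le> c * ?g x"
    using \<open>c > 0\<close> by (simp add: field_simps)
qed

text \<open>When \<open>q\<close> is minimal, \<open>r\<close> must equal \<open>q\<close>, and the
  last inequality becomes superadditivity of \<open>q\<close>. The witness is an infimum over
  \<open>t \<ge> 0\<close>: the value \<open>t = 0\<close> gives \<open>r \<le> q\<close>, and
  \<open>t = 1\<close> gives the last inequality.\<close>

lemma sublinear_minorant_tilted:
  assumes q: "sublinear q"
  obtains r where "sublinear r" and "r \<le> q" and "\<And>x. r x \<le> q (x + y) - q y"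
proof
  define r where "r = (\<lambda>x. INF t\<in>{0::real..}. q (x + t *\<^sub>R y) - t * q y)"
  \<comment> \<open>This bound does not depend on \<open>t\<close>, so the infimum defining
    \<open>r\<close> is over a set bounded below.\<close>
  have low: "- q (- x) \<le> q (x + t *\<^sub>R y) - t * q y" if "t \<ge> 0" for t x
  proof -
    have "t * q y = q (t *\<^sub>R y)"
      using that sublinear_scale[OF q] sublinear_zero[OF q] by (cases "t = 0") auto
    also have "\<dots> \<le> q (x + t *\<^sub>R y) + q (- x)"
      using sublinear_add[OF q, of "x + t *\<^sub>R y" "- x"] by simp
    finally show ?thesis by simp
  qed
  have bdd: "bdd_below ((\<lambda>t. q (x + t *\<^sub>R y) - t * q y) ` {0..})" for x
    using low by (intro bdd_belowI2[where m = "- q (- x)"]) auto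
  have le: "r x \<le> q (x + t *\<^sub>R y) - t * q y" if "t \<ge> 0" for t x
    unfolding r_def using that by (intro cINF_lower[OF bdd]) auto
  have ge: "m \<le> r x" if "\<And>t. t \<ge> 0 \<Longrightarrow> m \<le> q (x + t *\<^sub>R y) - t * q y" for m x
    unfolding r_def using that by (intro cINF_greatest) auto
  show "sublinear r"
  proof (rule sublinearI)
    fix x z
    \<comment> \<open>The parameters add: \<open>s\<close> for \<open>x\<close> and \<open>t\<close>
      for \<open>z\<close> combine to \<open>s + t\<close> for \<open>x + z\<close>.\<close>
    have *: "r (x + z) \<le> (q (x + s *\<^sub>R y) - s * q y) + (q (z + t *\<^sub>R y) - t * q y)"
      if "s \<ge> 0" "t \<ge> 0" for s t
    proof -
      have "r (x + z) \<le> q ((x + z) + (s + t) *\<^sub>R y) - (s + t) * q y"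
        using that by (intro le) auto
      also have "(x + z) + (s + t) *\<^sub>R y = (x + s *\<^sub>R y) + (z + t *\<^sub>R y)"
        by (simp add: algebra_simps)
      also have "q \<dots> \<le> q (x + s *\<^sub>R y) + q (z + t *\<^sub>R y)"
        by (rule sublinear_add[OF q])
      finally show ?thesis by (simp add: algebra_simps)
    qed
    have "r (x + z) - (q (z + t *\<^sub>R y) - t * q y) \<le> r x" if "t \<ge> 0" for t
      using *[OF _ that] by (intro ge) (simp add: algebra_simps)
    then have "r (x + z) - r x \<le> r z"
      by (intro ge) (simp add: algebra_simps)
    then show "r (x + z) \<le> r x + r z" by simp
  next
    fix c :: real and x
    assume c: "c > 0"
    have "r (c *\<^sub>R x) / c \<le> r x"
    proof (rule ge)
      fix t :: real assume "t \<ge> 0"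
      have "r (c *\<^sub>R x) \<le> q (c *\<^sub>R x + (c * t) *\<^sub>R y) - (c * t) * q y"
        using c \<open>t \<ge> 0\<close> by (intro le) auto
      also have "c *\<^sub>R x + (c * t) *\<^sub>R y = c *\<^sub>R (x + t *\<^sub>R y)"
        by (simp add: algebra_simps)
      also have "q \<dots> = c * q (x + t *\<^sub>R y)"
        by (rule sublinear_scale[OF q c])
      finally show "r (c *\<^sub>R x) / c \<le> q (x + t *\<^sub>R y) - t * q y"
        using c by (simp add: field_simps)
    qed
    then show "r (c *\<^sub>R x) \<le> c * r x"
      using c by (simp add: field_simps)
  qed
  show "r \<le> q" using le[of 0] by (simp add: le_fun_def)
  show "r x \<le> q (x + y) - q y" for x using le[of 1 x] by simp
qed

text \<open>Minimal sublinear functionals are linear, so Zorn's lemma yields a linear minorant.\<close>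

theorem hahn_banach_sublinear:
  assumes p: "sublinear p"
  obtains l where "linear l" and "\<And>x. l x \<le> p x"
proof -
  define A where "A = {q. sublinear q \<and> q \<le> p}"
  \<comment> \<open>Zorn's lemma is applied to the reversed order, so the element obtained is a
    minimal sublinear functional below \<open>p\<close>.\<close>
  have "\<exists>m\<in>A. \<forall>a\<in>A. m \<ge> a \<longrightarrow> a = m"
  proof (rule predicate_Zorn)
    show "partial_order_on A (relation_of (\<ge>) A)"
      by (rule partial_order_on_relation_ofI) auto
    fix C assume C: "C \<in> Chains (relation_of (\<ge>) A)"
    then have CA: "C \<subseteq> A"
      by (rule Chains_relation_of)
    show "\<exists>u\<in>A. \<forall>a\<in>C. a \<ge> u"
    proof (cases "C = {}")
      case True
      then show ?thesis using p by (auto simp: A_def)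
    next
      case False
      have bdd: "bdd_below ((\<lambda>f. f x) ` C)" for x
      proof (rule bdd_belowI2)
        fix f assume "f \<in> C"
        then have "sublinear f" "f (- x) \<le> p (- x)"
          using CA by (auto simp: A_def le_fun_def)
        then show "- p (- x) \<le> f x"
          using sublinear_minus[of f x] by simp
      qed
      define u where "u = (\<lambda>x. INF f\<in>C. f x)"
      have u: "u \<le> f" if "f \<in> C" for f
        unfolding u_def le_fun_def using cINF_lower[OF bdd that] by blast
      have "sublinear u"
        unfolding u_def
      proof (rule sublinear_INF_chain[OF False _ _ bdd])
        show "sublinear f" if "f \<in> C" for f using that CA by (auto simp: A_def)
        show "f \<le> g \<or> g \<le> f" if "f \<in> C" "g \<in> C" for f g
          using C that by (auto simp: Chains_def relation_of_def)
      qed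
      moreover have "u \<le> p"
        using False u CA by (fastforce simp: A_def)
      ultimately show ?thesis using u by (auto simp: A_def)
    qed
  qed
  \<comment> \<open>Minimality in \<open>A\<close> covers every sublinear \<open>r \<le> q\<close>,
    since such an \<open>r\<close> also lies below \<open>p\<close>.\<close>
  then obtain q where q: "sublinear q" "q \<le> p"
    and min: "\<And>r. sublinear r \<Longrightarrow> r \<le> q \<Longrightarrow> r = q"
    unfolding A_def by (auto intro: order_trans)
  have add: "q (x + y) = q x + q y" for x y
  proof -
    obtain r where r: "sublinear r" "r \<le> q" "\<And>x. r x \<le> q (x + y) - q y"
      using sublinear_minorant_tilted[OF q(1)] by blast
    have "r = q" by (rule min[OF r(1,2)])
    with r(3)[of x] sublinear_add[OF q(1), of x y] show ?thesis by simp
  qed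
  have neg: "q (- x) = - q x" for x
    using add[of x "- x"] sublinear_zero[OF q(1)] by simp
  have "linear q"
  proof (rule linearI)
    fix c :: real and x
    consider "c > 0" | "c = 0" | "- c > 0" by linarith
    then show "q (c *\<^sub>R x) = c *\<^sub>R q x"
    proof cases
      case 3
      have "q (c *\<^sub>R x) = q ((- c) *\<^sub>R (- x))" by simp
      also have "\<dots> = - c * q (- x)" by (rule sublinear_scale[OF q(1) 3])
      finally show ?thesis by (simp add: neg)
    qed (simp_all add: sublinear_scale[OF q(1)] sublinear_zero[OF q(1)])
  qed (rule add)
  then show thesis using q(2) by (intro that) (auto simp: le_fun_def)
qed

section \<open>Subgradients of continuous convex functions\<close>

text \<open>The witness is the one-sided directional derivative of \<open>f\<close> at \<open>x\<close>.\<close>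

lemma convex_on_sublinear_minorant:
  fixes f :: "'a::real_vector \<Rightarrow> real"
  assumes f: "convex_on UNIV f"
  obtains p where "sublinear p" and "\<And>v. p v \<le> f (x + v) - f x"
proof
  define D where "D = (\<lambda>v t. (f (x + t *\<^sub>R v) - f x) / t)"
  define p where "p = (\<lambda>v. INF t\<in>{0<..}. D v t)"
  \<comment> \<open>Jensen's inequality for two positive weights that need not sum to 1.\<close>
  have conv: "(a + b) * f ((a / (a + b)) *\<^sub>R y + (b / (a + b)) *\<^sub>R z) \<le> a * f y + b * f z"
    if "a > 0" "b > 0" for a b y z
  proof -
    have "f ((a / (a + b)) *\<^sub>R y + (b / (a + b)) *\<^sub>R z) \<le> a / (a + b) * f y + b / (a + b) * f z"
      using f[unfolded convex_on_def, THEN conjunct2, rule_format, of y z "a / (a + b)" "b / (a + b)"]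
        that by (simp add: add_divide_distrib[symmetric])
    also have "\<dots> = (a * f y + b * f z) / (a + b)" by (simp add: add_divide_distrib)
    finally show ?thesis using that by (simp add: field_simps)
  qed
  \<comment> \<open>The point \<open>x\<close> is the mean of \<open>x + t *\<^sub>R v\<close> and
    \<open>x - v\<close> with weights \<open>1\<close> and \<open>t\<close>, so convexity bounds all
    quotients below, uniformly in \<open>t\<close>.\<close>
  have low: "f x - f (x - v) \<le> D v t" if "t > 0" for t v
  proof -
    have "(1 / (1 + t)) *\<^sub>R (x + t *\<^sub>R v) + (t / (1 + t)) *\<^sub>R (x - v)
        = (1 / (1 + t) + t / (1 + t)) *\<^sub>R x"
      by (simp add: algebra_simps)
    also have "\<dots> = x" using that by (simp add: add_divide_distrib[symmetric])
    finally have "(1 + t) * f x \<le> f (x + t *\<^sub>R v) + t * f (x - v)"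
      using conv[of 1 t "x + t *\<^sub>R v" "x - v"] that by simp
    then show ?thesis using that by (simp add: D_def field_simps)
  qed
  have bdd: "bdd_below (D v ` {0<..})" for v
    using low by (intro bdd_belowI2[where m = "f x - f (x - v)"]) auto
  have le: "p v \<le> D v t" if "t > 0" for t v
    unfolding p_def using that by (intro cINF_lower[OF bdd]) auto
  have ge: "m \<le> p v" if "\<And>t. t > 0 \<Longrightarrow> m \<le> D v t" for m v
    unfolding p_def using that by (intro cINF_greatest) auto
  show "sublinear p"
  proof (rule sublinearI)
    fix v w
    have *: "p (v + w) \<le> D v s + D w t" if "s > 0" "t > 0" for s t
    proof -
      \<comment> \<open>With this step length, \<open>x + r *\<^sub>R (v + w)\<close> is the mean of
        \<open>x + s *\<^sub>R v\<close> and \<open>x + t *\<^sub>R w\<close> with weights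
        \<open>t\<close> and \<open>s\<close>.\<close>
      define r where "r = s * t / (s + t)"
      have "r > 0" using that by (simp add: r_def)
      have "(t / (t + s)) *\<^sub>R (x + s *\<^sub>R v) + (s / (t + s)) *\<^sub>R (x + t *\<^sub>R w)
          = (t / (t + s) + s / (t + s)) *\<^sub>R x + r *\<^sub>R (v + w)"
        by (simp add: r_def algebra_simps)
      also have "t / (t + s) + s / (t + s) = 1"
        using that by (simp add: add_divide_distrib[symmetric])
      finally have "(s + t) * f (x + r *\<^sub>R (v + w)) \<le> t * f (x + s *\<^sub>R v) + s * f (x + t *\<^sub>R w)"
        using conv[of t s "x + s *\<^sub>R v" "x + t *\<^sub>R w"] that by (simp add: add.commute)
      then have "(s + t) * (f (x + r *\<^sub>R (v + w)) - f x) / (s * t)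
          \<le> (t * (f (x + s *\<^sub>R v) - f x) + s * (f (x + t *\<^sub>R w) - f x)) / (s * t)"
        using that by (intro divide_right_mono) (auto simp: algebra_simps)
      also have "\<dots> = D v s + D w t"
        using that by (simp add: D_def field_simps)
      also have "(s + t) * (f (x + r *\<^sub>R (v + w)) - f x) / (s * t) = D (v + w) r"
        by (simp add: D_def r_def)
      finally show ?thesis using le[OF \<open>r > 0\<close>, of "v + w"] by simp
    qed
    have "p (v + w) - D w t \<le> p v" if "t > 0" for t
      using *[OF _ that] by (intro ge) (simp add: algebra_simps)
    then have "p (v + w) - p v \<le> p w"
      by (intro ge) (simp add: algebra_simps)
    then show "p (v + w) \<le> p v + p w" by simp
  next
    fix c :: real and v
    assume c: "c > 0"
    have "p (c *\<^sub>R v) / c \<le> p v"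
    proof (rule ge)
      fix t :: real assume "t > 0"
      \<comment> \<open>The step \<open>t / c\<close> along \<open>c *\<^sub>R v\<close> reaches the
        same point as the step \<open>t\<close> along \<open>v\<close>.\<close>
      then have "p (c *\<^sub>R v) \<le> D (c *\<^sub>R v) (t / c)"
        using c by (intro le) auto
      also have "\<dots> = c * D v t" using c by (simp add: D_def)
      finally show "p (c *\<^sub>R v) / c \<le> D v t" using c by (simp add: field_simps)
    qed
    then show "p (c *\<^sub>R v) \<le> c * p v"
      using c by (simp add: field_simps)
  qed
  show "p v \<le> f (x + v) - f x" for v
    using le[of 1 v] by (simp add: D_def)
qed

text \<open>Rescaling a nonzero vector to norm \<open>d\<close> bounds \<open>l\<close> above by a
  multiple of the norm; the same bound at \<open>- x\<close> controls \<open>l x\<close> from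
  below.\<close>

lemma bounded_linear_if_bounded_above:
  fixes l :: "'a::real_normed_vector \<Rightarrow> real"
  assumes l: "linear l" and "d > 0" and le: "\<And>v. norm v \<le> d \<Longrightarrow> l v \<le> B"
  shows "bounded_linear l"
proof (rule bounded_linear_intro)
  interpret linear l by (rule l)
  show "l (x + y) = l x + l y" "l (r *\<^sub>R x) = r *\<^sub>R l x" for x y r
    by (simp_all add: add scale)
  fix x :: 'a
  show "norm (l x) \<le> norm x * (B / d)"
  proof (cases "x = 0")
    case False
    have *: "l y \<le> norm y * (B / d)" if "y \<noteq> 0" for y
    proof -
      have "l ((d / norm y) *\<^sub>R y) \<le> B" using that \<open>d > 0\<close> by (intro le) simp
      then show ?thesis using that \<open>d > 0\<close> by (simp add: scale field_simps)
    qed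
    show ?thesis using *[of x] *[of "- x"] False by (simp add: neg)
  qed (simp add: zero)
qed

text \<open>A linear functional below the directional derivative satisfies the subgradient
  inequality. Continuity of \<open>f\<close> at \<open>x\<close> bounds it above on a ball, which
  makes it a member of the dual.\<close>

theorem continuous_convex_subgradient:
  fixes f :: "'a::real_normed_vector \<Rightarrow> real"
  assumes "convex_on UNIV f" and "isCont f x"
  obtains x' :: "'a dual" where "\<And>y. blinfun_apply x' (y - x) \<le> f y - f x"
proof -
  obtain p where p: "sublinear p" "\<And>v. p v \<le> f (x + v) - f x"
    using convex_on_sublinear_minorant[OF assms(1)] by blast
  obtain l where l: "linear l" "\<And>v. l v \<le> p v"
    using hahn_banach_sublinear[OF p(1)] by blast
  have lf: "l v \<le> f (x + v) - f x" for v
    using l(2)[of v] p(2)[of v] by simp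
  obtain d where d: "d > 0" "\<And>y. dist y x < d \<Longrightarrow> dist (f y) (f x) < 1"
    using assms(2) unfolding continuous_at_eps_delta by (metis zero_less_one)
  have "bounded_linear l"
  proof (rule bounded_linear_if_bounded_above[OF l(1)])
    \<comment> \<open>Halving \<open>d\<close> fits a closed ball into the open ball given by
      continuity.\<close>
    show "d / 2 > 0" using d(1) by simp
    show "l v \<le> 1" if "norm v \<le> d / 2" for v
      using lf[of v] d(2)[of "x + v"] d(1) that by (simp add: dist_norm)
  qed
  then show thesis
    using lf[of "_ - x"] by (intro that[of "Blinfun l"]) (simp add: bounded_linear_Blinfun_apply)
qed

section \<open>Monotonicity and maximality of the operator\<close>

text \<open>Add the defining inequality of \<open>x'\<close> at \<open>y\<close> to that of
  \<open>y'\<close> at \<open>x\<close>; the right-hand sides sum to at most 0.\<close>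

lemma monotone_operator_bifunction_operator:
  assumes "monotone_bifunction F" and "\<And>x. F x x = 0"
  shows "monotone_operator (bifunction_operator F)"
  unfolding monotone_operator_def
proof (intro allI ballI)
  fix x y x' y'
  assume "x' \<in> bifunction_operator F x" and "y' \<in> bifunction_operator F y"
  then have "blinfun_apply x' (y - x) \<le> F x y" and "blinfun_apply y' (x - y) \<le> F y x"
    by (simp_all add: bifunction_operator_def assms(2))
  moreover have "F x y + F y x \<le> 0"
    using assms(1) by (simp add: monotone_bifunction_def)
  ultimately show "blinfun_apply (y' - x') (y - x) \<ge> 0"
    by (simp add: blinfun.diff_left blinfun.diff_right)
qed

text \<open>If \<open>f x < a\<close>, semicontinuity keeps \<open>f\<close> below some
  \<open>c < a\<close> on the segment near \<open>x\<close>, whereas the lower bounds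
  \<open>(1 - t) * a\<close> tend to \<open>a\<close>.\<close>

lemma upper_hemicontinuous_ge:
  fixes f :: "'a::real_normed_vector \<Rightarrow> real"
  assumes f: "upper_hemicontinuous f"
    and ge: "\<And>t. 0 < t \<Longrightarrow> t < 1 \<Longrightarrow> (1 - t) * a \<le> f (x + t *\<^sub>R (y - x))"
    and "x \<noteq> y"
  shows "a \<le> f x"
proof (rule ccontr)
  assume "\<not> a \<le> f x"
  then obtain c where c: "f x < c" "c < a" using dense[of "f x" a] by auto
  have "\<forall>\<^sub>F z in at x within closed_segment x y. f z < c"
    using f c(1) unfolding upper_hemicontinuous_def upper_semicontinuous_on_def by auto
  then obtain d where d: "d > 0"
    "\<And>z. z \<in> closed_segment x y \<Longrightarrow> z \<noteq> x \<Longrightarrow> dist z x < d \<Longrightarrow> f z < c"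
    unfolding eventually_at by blast
  \<comment> \<open>The three terms ensure in turn \<open>t < 1\<close>, a distance to
    \<open>x\<close> below \<open>d\<close>, and \<open>t * a \<le> a - c\<close>. Adding 1 to
    \<open>\<bar>a\<bar>\<close> keeps the denominator positive.\<close>
  define t where "t = min (1 / 2) (min (d / (2 * norm (y - x))) ((a - c) / (\<bar>a\<bar> + 1)))"
  have t: "0 < t" "t < 1" using c d(1) \<open>x \<noteq> y\<close> by (auto simp: t_def)
  have "t \<le> d / (2 * norm (y - x))" by (simp add: t_def)
  then have "t * norm (y - x) < d" using d(1) \<open>x \<noteq> y\<close> by (simp add: field_simps)
  moreover have "x + t *\<^sub>R (y - x) \<in> closed_segment x y"
    using t by (auto simp: in_segment algebra_simps intro!: exI[of _ t])
  ultimately have "f (x + t *\<^sub>R (y - x)) < c"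
    using t \<open>x \<noteq> y\<close> by (intro d(2)) (auto simp: dist_norm)
  with ge[OF t] have "(1 - t) * a < c" by simp
  moreover have "t * a \<le> a - c"
  proof -
    have "t * a \<le> t * (\<bar>a\<bar> + 1)" using t by (intro mult_left_mono) auto
    also have "\<dots> \<le> (a - c) / (\<bar>a\<bar> + 1) * (\<bar>a\<bar> + 1)"
      by (intro mult_right_mono) (auto simp: t_def)
    finally show ?thesis by simp
  qed
  ultimately show False by (simp add: algebra_simps)
qed

lemma monotonically_related_in_bifunction_operator:
  fixes F :: "'a::real_normed_vector \<Rightarrow> 'a \<Rightarrow> real"
  assumes diagonal: "\<And>x. F x x = 0"
    and convex: "\<And>x. convex_on UNIV (F x)"
    and continuous: "\<And>x. continuous_on UNIV (F x)"
    and hemicontinuous: "\<And>y. upper_hemicontinuous (\<lambda>x. F x y)"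
    and related: "\<And>z z'. z' \<in> bifunction_operator F z \<Longrightarrow> blinfun_apply (z' - x') (z - x) \<ge> 0"
  shows "x' \<in> bifunction_operator F x"
proof -
  have "blinfun_apply x' (y - x) \<le> F x y" if "x \<noteq> y" for y
  proof (rule upper_hemicontinuous_ge[OF hemicontinuous _ that])
    fix t :: real assume t: "0 < t" "t < 1"
    define z where "z = x + t *\<^sub>R (y - x)"
    have "isCont (F z) z"
      using continuous[of z] by (simp add: continuous_on_eq_continuous_at)
    then obtain z' where z': "\<And>w. blinfun_apply z' (w - z) \<le> F z w - F z z"
      using continuous_convex_subgradient[OF convex] by blast
    then have "blinfun_apply (z' - x') (z - x) \<ge> 0"
      by (intro related) (simp add: bifunction_operator_def)
    \<comment> \<open>Here \<open>z - x = t *\<^sub>R (y - x)\<close>, and the positive factor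
      \<open>t\<close> cancels.\<close>
    then have "blinfun_apply x' (y - x) \<le> blinfun_apply z' (y - x)"
      using t by (simp add: z_def blinfun.diff_left blinfun.scaleR_right zero_le_mult_iff)
    then have "(1 - t) * blinfun_apply x' (y - x) \<le> (1 - t) * blinfun_apply z' (y - x)"
      using t by (intro mult_left_mono) auto
    also have "\<dots> = blinfun_apply z' (y - z)"
    proof -
      have "y - z = (1 - t) *\<^sub>R (y - x)" by (simp add: z_def algebra_simps)
      then show ?thesis by (simp add: blinfun.scaleR_right)
    qed
    also have "\<dots> \<le> F z y" using z'[of y] by (simp add: diagonal)
    finally show "(1 - t) * blinfun_apply x' (y - x) \<le> F (x + t *\<^sub>R (y - x)) y"
      by (simp add: z_def)
  qed
  \<comment> \<open>For \<open>x = y\<close>, where the segment degenerates, both sides are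
    0.\<close>
  then have "blinfun_apply x' (y - x) \<le> F x y" for y
    by (cases "x = y") (simp_all add: diagonal)
  then show ?thesis by (simp add: bifunction_operator_def diagonal)
qed

theorem theorem11:
  fixes F :: "'a::banach \<Rightarrow> 'a \<Rightarrow> real"
  assumes nontrivial: "\<exists>v::'a. v \<noteq> 0"
    and monotone: "monotone_bifunction F"
    and diagonal: "\<And>x. F x x = 0"
    and convex: "\<And>x. convex_on UNIV (\<lambda>y. F x y)"
    and continuous: "\<And>x. continuous_on UNIV (\<lambda>y. F x y)"
    and hemicontinuous: "\<And>y. upper_hemicontinuous (\<lambda>x. F x y)"
  shows "maximal_monotone_bifunction F"
proof -
  \<comment> \<open>Monotonicity of \<open>S\<close> makes each of its pairs monotonically related
    to the smaller graph, so no extension is proper.\<close>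
  have "operator_graph S \<subseteq> operator_graph (bifunction_operator F)"
    if S: "monotone_operator S" "operator_graph (bifunction_operator F) \<subseteq> operator_graph S" for S
  proof (clarsimp simp: operator_graph_def)
    fix x x' assume "x' \<in> S x"
    show "x' \<in> bifunction_operator F x"
    proof (rule monotonically_related_in_bifunction_operator
        [OF diagonal convex continuous hemicontinuous])
      fix z z' assume "z' \<in> bifunction_operator F z"
      then have "z' \<in> S z" using S(2) by (auto simp: operator_graph_def)
      with \<open>x' \<in> S x\<close> show "blinfun_apply (z' - x') (z - x) \<ge> 0"
        using S(1) by (simp add: monotone_operator_def)
    qed
  qed
  then show ?thesis
    using monotone monotone_operator_bifunction_operator[OF monotone diagonal]
    by (auto simp: maximal_monotone_bifunction_def maximal_monotone_operator_def)
qed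

end
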